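(* Let $(V,E)$ be a finite oriented graph and let $U(E)$ be the set of its unbranched subgraphs. Then all the zeros (in $\mathbb{C}$) of the unbranched subgraph counting polynomial $$p_{\rm unbranched}(z)=\sum_{F\in U(E)}z^{|F|}$$ are real and $<0$.
   Context: An oriented graph is a pair $(V,E)$ of finite sets with $V\ne\emptyset$, together with two maps $x',x'':E\to V$ such that $x'(e)\ne x''(e)$ for all $e\in E$. Elements of $V$ are vertices; elements $e\in E$ are oriented edges, going from $x'(e)$ to $x''(e)$. Different edges are allowed to have the same endpoints, with the same or the opposite orientation. A subgraph of $(V,E)$ is a subset $F\subset E$, and $|F|$ denotes its number of edges. A subgraph $F$ is unbranched if for each $x\in V$, $$|\{e\in F: x'(e)=x\}|\le 1\quad\text{and}\quad |\{e\in F: x''(e)=x\}|\le 1.$$ $U(E)$ denotes the set of all unbranched subgraphs of $(V,E)$; in particular $\emptyset\in U(E)$. *)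

theory Defs
  imports "HOL-Analysis.Analysis" "HOL-Computational_Algebra.Polynomial" "Graph_Theory.Digraph"
begin

text \<open>
  In the record \<open>pre_digraph\<close>, the maps \<open>tail G\<close> and \<open>head G\<close> play the roles of \<open>x'\<close> and \<open>x''\<close>.
  Parallel arcs and pairs of opposite arcs are allowed.
\<close>

locale oriented_graph = fin_digraph + loopfree_digraph +
  assumes verts_nonempty: "verts G \<noteq> {}"

definition unbranched :: "('a, 'b) pre_digraph \<Rightarrow> 'b set \<Rightarrow> bool" where
  "unbranched G F \<longleftrightarrow> F \<subseteq> arcs G \<and>
     (\<forall>x \<in> verts G. card {e \<in> F. tail G e = x} \<le> 1 \<and> card {e \<in> F. head G e = x} \<le> 1)"

definition unbranched_subgraphs :: "('a, 'b) pre_digraph \<Rightarrow> 'b set set" where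
  "unbranched_subgraphs G = {F. unbranched G F}"

definition p_unbranched :: "('a, 'b) pre_digraph \<Rightarrow> complex poly" where
  "p_unbranched G = (\<Sum>F \<in> unbranched_subgraphs G. monom 1 (card F))"

end

(*
  Splitting every vertex into an out-copy and an in-copy turns unbranched subgraphs into the
  matchings of a bipartite multigraph, so the theorem is an instance of the Heilmann-Lieb theorem.
  For the latter put z = -1/x^2 with Im x > 0 and r(E,v) = x m(E) / m(E - v), where m is the matching
  polynomial at z and E - v consists of the edges avoiding v. Expanding m(E) at v gives
  r(E,v) = x - sum of 1 / r(E - v, u) over the edges {u,v}, so all r(E,v) stay in the upper half-plane
  and m(E) does not vanish.
*)
theory Submission
  imports Defs
begin

text \<open>An edge \<open>e\<close> of a multigraph is represented by its set \<open>N e\<close> of endpoints.\<close>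

definition matchings :: "('e \<Rightarrow> 'v set) \<Rightarrow> 'e set \<Rightarrow> 'e set set" where
  "matchings N E = {M. M \<subseteq> E \<and> (\<forall>e\<in>M. \<forall>f\<in>M. e \<noteq> f \<longrightarrow> N e \<inter> N f = {})}"

text \<open>The matching generating function: for a graph with n vertices, x^n times its value at
  -1/x^2 is the usual signed matching polynomial. Without the factor x^n isolated vertices leave no
  trace, so edge sets alone suffice.\<close>

definition matching_sum :: "('e \<Rightarrow> 'v set) \<Rightarrow> 'a::comm_ring_1 \<Rightarrow> 'e set \<Rightarrow> 'a" where
  "matching_sum N z E = (\<Sum>M\<in>matchings N E. z ^ card M)"

definition delete_vertex :: "('e \<Rightarrow> 'v set) \<Rightarrow> 'v \<Rightarrow> 'e set \<Rightarrow> 'e set" where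
  "delete_vertex N v E = {e \<in> E. v \<notin> N e}"

lemma matchings_empty [simp]: "matchings N {} = {{}}"
  by (auto simp: matchings_def)

lemma matching_sum_empty [simp]: "matching_sum N z {} = 1"
  by (simp add: matching_sum_def)

lemma finite_matchings: "finite E \<Longrightarrow> finite (matchings N E)"
  by (rule finite_subset[of _ "Pow E"]) (auto simp: matchings_def)

text \<open>A matching contains at most one edge \<open>e\<close> at \<open>v\<close>, and its other
  edges then avoid every endpoint of \<open>e\<close>.\<close>

lemma matchings_vertex_decomposition:
  "matchings N E = matchings N (delete_vertex N v E) \<union>
     (\<Union>e\<in>{e\<in>E. v \<in> N e}. insert e ` matchings N {f\<in>E. N f \<inter> N e = {}})"
  (is "?L = ?A \<union> ?B")
proof (intro equalityI subsetI)
  fix M assume M: "M \<in> ?L"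
  show "M \<in> ?A \<union> ?B"
  proof (cases "\<exists>e\<in>M. v \<in> N e")
    case True
    then obtain e where e: "e \<in> M" "v \<in> N e" by blast
    have "M - {e} \<in> matchings N {f\<in>E. N f \<inter> N e = {}}"
      using M e by (auto simp: matchings_def)
    moreover have "M = insert e (M - {e})" using e by blast
    ultimately show ?thesis using M e unfolding matchings_def by blast
  next
    case False
    then show ?thesis using M by (auto simp: matchings_def delete_vertex_def)
  qed
next
  fix M assume "M \<in> ?A \<union> ?B"
  then show "M \<in> ?L"
  proof
    assume "M \<in> ?A"
    then show ?thesis by (auto simp: matchings_def delete_vertex_def)
  next
    assume "M \<in> ?B"
    then obtain e M' where e: "e \<in> E" "M = insert e M'"
      and M': "M' \<in> matchings N {f\<in>E. N f \<inter> N e = {}}" by blast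
    have d: "N f \<inter> N e = {}" "N e \<inter> N f = {}" if "f \<in> M'" for f
      using M' that unfolding matchings_def by blast+
    have d': "N f \<inter> N g = {}" if "f \<in> M'" "g \<in> M'" "f \<noteq> g" for f g
      using M' that unfolding matchings_def by blast
    have "M \<subseteq> E" using M' e unfolding matchings_def by blast
    then show ?thesis using d d' unfolding matchings_def e(2) by blast
  qed
qed

lemma matching_sum_vertex_expansion:
  assumes "finite E"
  shows "matching_sum N z E = matching_sum N z (delete_vertex N v E) +
     z * (\<Sum>e\<in>{e\<in>E. v \<in> N e}. matching_sum N z {f\<in>E. N f \<inter> N e = {}})"
proof -
  let ?I = "{e\<in>E. v \<in> N e}"
  let ?C = "\<lambda>e. matchings N {f\<in>E. N f \<inter> N e = {}}"
  have fin: "finite (?C e)" for e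
    using assms by (intro finite_matchings) simp
  have e_notin: "e \<notin> M" if "M \<in> ?C e" "e \<in> ?I" for e M
    using that unfolding matchings_def by blast
  \<comment> \<open>Distinct edges at \<open>v\<close> share that endpoint, so no matching is
    counted for two of them.\<close>
  have disj: "insert e ` ?C e \<inter> insert f ` ?C f = {}" if ef: "e \<in> ?I" "f \<in> ?I" "e \<noteq> f" for e f
  proof (rule ccontr)
    assume "\<not> ?thesis"
    then obtain X where "X \<in> insert e ` ?C e" "X \<in> insert f ` ?C f" by blast
    then obtain M M' where M: "insert e M = insert f M'" "M \<in> ?C e"
      by (elim imageE) simp
    then have "f \<in> M" using ef(3) by (metis insertE insertI1)
    then have "N f \<inter> N e = {}" using M(2) unfolding matchings_def by blast
    then show False using ef by blast
  qed
  have inner: "(\<Sum>M\<in>insert e ` ?C e. z ^ card M) =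
      z * matching_sum N z {f\<in>E. N f \<inter> N e = {}}" if e: "e \<in> ?I" for e
  proof -
    have "inj_on (insert e) (?C e)"
      using e_notin[OF _ e] by (auto intro!: inj_onI dest: insert_ident)
    then have "(\<Sum>M\<in>insert e ` ?C e. z ^ card M) = (\<Sum>M\<in>?C e. z ^ card (insert e M))"
      by (simp add: sum.reindex)
    also have "\<dots> = (\<Sum>M\<in>?C e. z * z ^ card M)"
    proof (rule sum.cong[OF refl])
      fix M assume M: "M \<in> ?C e"
      then have "finite M" using assms
        by (auto simp: matchings_def intro: finite_subset)
      then show "z ^ card (insert e M) = z * z ^ card M" using e_notin[OF M e] by simp
    qed
    finally show ?thesis by (simp add: matching_sum_def sum_distrib_left)
  qed
  have "matching_sum N z E = (\<Sum>M\<in>matchings N (delete_vertex N v E). z ^ card M) +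
      (\<Sum>M\<in>(\<Union>e\<in>?I. insert e ` ?C e). z ^ card M)"
    unfolding matching_sum_def matchings_vertex_decomposition[of N E v]
  proof (rule sum.union_disjoint)
    show "finite (matchings N (delete_vertex N v E))"
      using assms by (intro finite_matchings) (simp add: delete_vertex_def)
    show "finite (\<Union>e\<in>?I. insert e ` ?C e)" using assms fin by simp
    show "matchings N (delete_vertex N v E) \<inter> (\<Union>e\<in>?I. insert e ` ?C e) = {}"
      unfolding matchings_def delete_vertex_def by blast
  qed
  also have "(\<Sum>M\<in>(\<Union>e\<in>?I. insert e ` ?C e). z ^ card M) =
      (\<Sum>e\<in>?I. \<Sum>M\<in>insert e ` ?C e. z ^ card M)"
    using assms fin disj by (intro sum.UNION_disjoint) auto
  finally show ?thesis
    by (simp add: inner matching_sum_def[of N z "delete_vertex N v E"] sum_distrib_left)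
qed

lemma Im_inverse_neg: "Im w > 0 \<Longrightarrow> Im (inverse w) < 0"
proof -
  assume "Im w > 0"
  then have "(Re w)\<^sup>2 + (Im w)\<^sup>2 > 0" by (simp add: add_nonneg_pos)
  with \<open>Im w > 0\<close> show ?thesis by simp
qed

text \<open>Since division by zero yields 0, a positive imaginary part also says that both sums are
  nonzero; the induction carries the nonvanishing along in this form.\<close>

lemma Im_matching_ratio_pos:
  fixes x :: complex
  assumes "finite E" and "\<And>e. e \<in> E \<Longrightarrow> card (N e) = 2" and "Im x > 0"
  defines "z \<equiv> - 1 / x\<^sup>2"
  shows "Im (x * matching_sum N z E / matching_sum N z (delete_vertex N v E)) > 0"
  using assms(1,2)
proof (induction E arbitrary: v rule: finite_psubset_induct)
  case (psubset E)
  let ?m = "matching_sum N z"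
  have "x \<noteq> 0" using assms(3) by auto
  \<comment> \<open>Proved for every covered vertex, because the case of an uncovered one is reduced
    to it below.\<close>
  have incident: "Im (x * ?m E / ?m (delete_vertex N v E)) > 0" if "\<exists>e\<in>E. v \<in> N e" for v
  proof -
    let ?D = "delete_vertex N v E"
    let ?I = "{e\<in>E. v \<in> N e}"
    have D: "?D \<subset> E" using that by (auto simp: delete_vertex_def)
    have IH: "Im (x * ?m ?D / ?m (delete_vertex N u ?D)) > 0" for u
      using psubset.IH[OF D] psubset.prems D by blast
    have "?m ?D \<noteq> 0" using IH[of v] by auto
    have "Im (?m {f\<in>E. N f \<inter> N e = {}} / (x * ?m ?D)) < 0" if e: "e \<in> ?I" for e
    proof -
      obtain a b where "N e = {a, b}"
        using psubset.prems[of e] e by (auto simp: card_2_iff)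
      then obtain u where "N e = {v, u}"
        using e by (cases "v = a") (auto simp: insert_commute)
      \<comment> \<open>This makes the quotient the reciprocal of the ratio for \<open>?D\<close>
        and \<open>u\<close>, which the induction hypothesis places in the upper half-plane.\<close>
      then have "{f\<in>E. N f \<inter> N e = {}} = delete_vertex N u ?D"
        by (auto simp: delete_vertex_def)
      then show ?thesis using Im_inverse_neg[OF IH[of u]] by (simp add: inverse_eq_divide)
    qed
    then have "(\<Sum>e\<in>?I. Im (?m {f\<in>E. N f \<inter> N e = {}} / (x * ?m ?D))) \<le> 0"
      by (intro sum_nonpos) (auto intro: less_imp_le)
    \<comment> \<open>Because \<open>x * z = - 1 / x\<close>, the edge terms of the vertex expansion
      enter with a minus sign.\<close>
    moreover have "x * ?m E / ?m ?D = x - (\<Sum>e\<in>?I. ?m {f\<in>E. N f \<inter> N e = {}} / (x * ?m ?D))"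
      using \<open>?m ?D \<noteq> 0\<close> \<open>x \<noteq> 0\<close> matching_sum_vertex_expansion[OF psubset.hyps(1), of N z v]
      by (simp add: z_def sum_divide_distrib[symmetric] field_simps power2_eq_square)
    ultimately show ?thesis using assms(3) by (simp add: Im_sum)
  qed
  show ?case
  proof (cases "\<exists>e\<in>E. v \<in> N e")
    case True
    then show ?thesis by (rule incident)
  next
    case False
    then have D: "delete_vertex N v E = E" by (auto simp: delete_vertex_def)
    \<comment> \<open>For uncovered \<open>v\<close> the ratio is \<open>x * ?m E / ?m E\<close>, so
      only nonvanishing is at stake; the ratio at any covered vertex \<open>w\<close> gives
      it.\<close>
    have "?m E \<noteq> 0"
    proof (cases "E = {}")
      case False
      then obtain e w where "e \<in> E" "w \<in> N e"
        using psubset.prems by (metis card.empty ex_in_conv zero_neq_numeral)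
      then show ?thesis using incident[of w] by (cases "?m E = 0") auto
    qed simp
    then show ?thesis using D assms(3) by simp
  qed
qed

text \<open>A nonzero z is -1/x^2 for both square roots of -1/z. At a zero neither root lies in the
  upper half-plane, so both are real and z is negative.\<close>

theorem Heilmann_Lieb:
  fixes z :: complex
  assumes "finite E" and "\<And>e. e \<in> E \<Longrightarrow> card (N e) = 2" and "matching_sum N z E = 0"
  shows "z \<in> \<real> \<and> Re z < 0"
proof -
  have nonzero: "matching_sum N (- 1 / x\<^sup>2) E \<noteq> 0" if "Im x > 0" for x :: complex
    using Im_matching_ratio_pos[where E = E and N = N, OF assms(1,2) that] by auto
  have "{} \<in> matchings N E" by (simp add: matchings_def)
  moreover have "finite M" if "M \<in> matchings N E" for M
    using that assms(1) by (auto simp: matchings_def intro: finite_subset)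
  \<comment> \<open>Only the empty matching contributes at 0, through
    \<open>0 ^ 0 = 1\<close>.\<close>
  ultimately have "matching_sum N (0::complex) E = 1"
    using finite_matchings[OF assms(1), of N]
    by (subst matching_sum_def, subst sum.remove[of _ "{}"]) (auto intro!: sum.neutral)
  then have "z \<noteq> 0" using assms(3) by auto
  define x where "x = csqrt (- 1 / z)"
  have z: "z = - 1 / x\<^sup>2" "z = - 1 / (- x)\<^sup>2"
    using \<open>z \<noteq> 0\<close> by (simp_all add: x_def)
  have "\<not> Im x > 0" "\<not> Im (- x) > 0"
    using nonzero[of x] nonzero[of "- x"] z assms(3) by metis+
  then have x: "x = of_real (Re x)" by (simp add: complex_eq_iff)
  then have "z = of_real (- 1 / (Re x)\<^sup>2)"
    using z(1) by (metis of_real_1 of_real_divide of_real_minus of_real_power)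
  moreover have "Re x \<noteq> 0" using z(1) \<open>z \<noteq> 0\<close> x by auto
  ultimately show ?thesis by simp
qed

context fin_digraph
begin

text \<open>The tags \<open>Inl\<close> and \<open>Inr\<close> keep tails apart from heads: distinct
  arcs conflict exactly when they share a tail or share a head, while the head of one may be the
  tail of another.\<close>

lemma unbranched_iff_matching:
  "unbranched G F \<longleftrightarrow> F \<in> matchings (\<lambda>e. {Inl (tail G e), Inr (head G e)}) (arcs G)"
proof -
  \<comment> \<open>Finiteness of \<open>F\<close> matters here, since \<open>card\<close> of an
    infinite set is 0.\<close>
  have card_le_1: "card {e\<in>F. t e = x} \<le> 1 \<longleftrightarrow> (\<forall>e\<in>F. \<forall>f\<in>F. t e = x \<longrightarrow> t f = x \<longrightarrow> e = f)"
    if "F \<subseteq> arcs G" for t :: "'b \<Rightarrow> 'a" and x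
    using finite_subset[OF that] finite_arcs
    by (subst One_nat_def, subst card_le_Suc0_iff_eq) auto
  show ?thesis
  proof (cases "F \<subseteq> arcs G")
    case True
    then have "tail G e \<in> verts G" "head G e \<in> verts G" if "e \<in> F" for e
      using that by auto
    \<comment> \<open>Tails and heads of arcs are vertices, so \<open>x\<close> can be instantiated
      with the endpoint of \<open>e\<close> itself.\<close>
    then have "(\<forall>x\<in>verts G. \<forall>e\<in>F. \<forall>f\<in>F. t e = x \<longrightarrow> t f = x \<longrightarrow> e = f) \<longleftrightarrow>
        (\<forall>e\<in>F. \<forall>f\<in>F. t e = t f \<longrightarrow> e = f)" if "t = tail G \<or> t = head G" for t
      using that by metis
    then have "unbranched G F \<longleftrightarrow>
        (\<forall>e\<in>F. \<forall>f\<in>F. (tail G e = tail G f \<longrightarrow> e = f) \<and> (head G e = head G f \<longrightarrow> e = f))"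
      unfolding unbranched_def card_le_1[OF True] using True by (simp add: ball_conj_distrib)
    also have "\<dots> \<longleftrightarrow> F \<in> matchings (\<lambda>e. {Inl (tail G e), Inr (head G e)}) (arcs G)"
      using True by (auto simp: matchings_def)
    finally show ?thesis .
  qed (auto simp: unbranched_def matchings_def)
qed

lemma poly_p_unbranched:
  "poly (p_unbranched G) z = matching_sum (\<lambda>e. {Inl (tail G e), Inr (head G e)}) z (arcs G)"
  by (simp add: p_unbranched_def unbranched_subgraphs_def unbranched_iff_matching
      matching_sum_def poly_sum poly_monom)

end

theorem mainTheorem1:
  fixes G :: "('a, 'b) pre_digraph" and z :: complex
  assumes "oriented_graph G"
    and "poly (p_unbranched G) z = 0"
  shows "z \<in> \<real> \<and> Re z < 0"
proof -
  interpret oriented_graph G by fact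
  show ?thesis
    using assms(2) by (intro Heilmann_Lieb) (auto simp: poly_p_unbranched)
qed

end
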